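(* Consider a Fisher market instance with finite agent set $\mathcal{A}$, finite goods set $\mathcal{M}$, (concave) utility functions $u_i:\mathbb{R}_{\ge 0}^{\mathcal{M}}\to\mathbb{R}_{\ge0}$ and budgets $b_i>0$, $i\in\mathcal{A}$. Let $((\mathbf{x}_i)_{i\in\mathcal{A}},\mathbf{p})$ be any competitive equilibrium and let $(\mathbf{y}_i)_{i\in\mathcal{A}}$ be a Nash welfare maximizing allocation. Then $$\left(\prod_{i\in\mathcal{A}} u_i(\mathbf{x}_i)^{b_i}\right)^{\frac{1}{\sum_{i\in\mathcal{A}} b_i}}\ \ge\ \left(\frac1e\right)^{\frac1e}\left(\prod_{i\in\mathcal{A}} u_i(\mathbf{y}_i)^{b_i}\right)^{\frac{1}{\sum_{i\in\mathcal{A}} b_i}} .$$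
   Context: Utility function: a function $u:\mathbb{R}_{\ge 0}^{\mathcal{M}}\to\mathbb{R}_{\ge 0}$ with $u(\mathbf{0})=0$ that is concave, continuous, monotone non-decreasing, and satisfies $u(\mathbf{x})>0$ for some $\mathbf{x}$. Fisher market instance: a finite set $\mathcal{A}$ of agents, a finite set $\mathcal{M}$ of divisible goods with one unit of each good available, and for each agent $i$ a utility function $u_i$ and a budget $b_i>0$. An allocation is $(\mathbf{x}_i)_{i\in\mathcal{A}}$ with $\mathbf{x}_i\in\mathbb{R}_{\ge 0}^{\mathcal{M}}$, where $x_{ij}$ is the amount of good $j$ given to agent $i$. A price vector is $\mathbf{p}\in\mathbb{R}_{\ge0}^{\mathcal{M}}$. Competitive equilibrium: an allocation and prices $((\mathbf{x}_i)_{i\in\mathcal{A}},\mathbf{p})$ such that (i) for every $i$, $\mathbf{x}_i$ maximizes $u_i(\mathbf{z})$ over $\{\mathbf{z}\in\mathbb{R}_{\ge 0}^{\mathcal{M}}:\langle\mathbf{p},\mathbf{z}\rangle\le b_i\}$; (ii) $\sum_i x_{ij}\le 1$ for all $j\in\mathcal{M}$; (iii) $\sum_i x_{ij}=1$ whenever $p_j>0$. Nash welfare of an allocation $(\mathbf{y}_i)$: $\left(\prod_{i} u_i(\mathbf{y}_i)^{b_i}\right)^{1/\sum_i b_i}$. A Nash welfare maximizing allocation attains the highest Nash welfare among all allocations with $\sum_i y_{ij}\le 1$ for all $j\in\mathcal{M}$. *)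

theory Defs
  imports "HOL-Analysis.Analysis"
begin

text \<open>
  The goods are the elements of a finite type \<open>'m\<close>. Bundles and prices are vectors in
  \<open>real ^ 'm\<close>, whose order is componentwise, so \<open>{0..}\<close> is the nonnegative orthant.
  A utility function is a total function, constrained only on \<open>{0..}\<close>.
\<close>

definition utility_function :: "(real ^ 'm::finite \<Rightarrow> real) \<Rightarrow> bool" where
  "utility_function u \<longleftrightarrow>
     u \<in> {0..} \<rightarrow> {0..} \<and> u 0 = 0 \<and>
     concave_on {0..} u \<and> continuous_on {0..} u \<and> mono_on {0..} u \<and>
     (\<exists>x\<in>{0..}. u x > 0)"

definition fisher_market ::
  "'a set \<Rightarrow> ('a \<Rightarrow> real ^ 'm::finite \<Rightarrow> real) \<Rightarrow> ('a \<Rightarrow> real) \<Rightarrow> bool" where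
  "fisher_market A u b \<longleftrightarrow>
     finite A \<and> (\<forall>i\<in>A. utility_function (u i)) \<and> (\<forall>i\<in>A. b i > 0)"

definition allocation :: "'a set \<Rightarrow> ('a \<Rightarrow> real ^ 'm::finite) \<Rightarrow> bool" where
  "allocation A x \<longleftrightarrow> (\<forall>i\<in>A. x i \<in> {0..})"

definition feasible :: "'a set \<Rightarrow> ('a \<Rightarrow> real ^ 'm::finite) \<Rightarrow> bool" where
  "feasible A x \<longleftrightarrow> (\<forall>j. (\<Sum>i\<in>A. x i $ j) \<le> 1)"

definition budget_set :: "real ^ 'm::finite \<Rightarrow> real \<Rightarrow> (real ^ 'm) set" where
  "budget_set p c = {z \<in> {0..}. p \<bullet> z \<le> c}"

definition competitive_equilibrium ::
  "'a set \<Rightarrow> ('a \<Rightarrow> real ^ 'm::finite \<Rightarrow> real) \<Rightarrow> ('a \<Rightarrow> real) \<Rightarrow>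
   ('a \<Rightarrow> real ^ 'm) \<Rightarrow> real ^ 'm \<Rightarrow> bool" where
  "competitive_equilibrium A u b x p \<longleftrightarrow>
     allocation A x \<and> p \<in> {0..} \<and>
     (\<forall>i\<in>A. x i \<in> budget_set p (b i) \<and> (\<forall>z\<in>budget_set p (b i). u i z \<le> u i (x i))) \<and>
     feasible A x \<and>
     (\<forall>j. p $ j > 0 \<longrightarrow> (\<Sum>i\<in>A. x i $ j) = 1)"

definition nash_welfare ::
  "'a set \<Rightarrow> ('a \<Rightarrow> real ^ 'm::finite \<Rightarrow> real) \<Rightarrow> ('a \<Rightarrow> real) \<Rightarrow> ('a \<Rightarrow> real ^ 'm) \<Rightarrow> real" where
  "nash_welfare A u b y = (\<Prod>i\<in>A. u i (y i) powr b i) powr (1 / (\<Sum>i\<in>A. b i))"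

definition nash_welfare_maximizing ::
  "'a set \<Rightarrow> ('a \<Rightarrow> real ^ 'm::finite \<Rightarrow> real) \<Rightarrow> ('a \<Rightarrow> real) \<Rightarrow> ('a \<Rightarrow> real ^ 'm) \<Rightarrow> bool" where
  "nash_welfare_maximizing A u b y \<longleftrightarrow>
     allocation A y \<and> feasible A y \<and>
     (\<forall>z. allocation A z \<and> feasible A z \<longrightarrow> nash_welfare A u b z \<le> nash_welfare A u b y)"

end

theory Submission
  imports Defs
begin

text \<open>
  If \<open>y i\<close> costs \<open>r * b i\<close> at the equilibrium prices, then scaling it down by \<open>r\<close> when
  \<open>r > 1\<close> makes it affordable, so concavity gives \<open>u i (y i) \<le> max 1 r * u i (x i)\<close>, and
  \<open>max 1 r \<le> exp (r / e)\<close>. Market clearing bounds the total cost of \<open>y\<close> by the total budget,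
  so in the weighted product the exponents \<open>b i * r / e\<close> add up to at most \<open>(\<Sum>i\<in>A. b i) / e\<close>.
\<close>

text \<open>The tangent bound \<open>1 + t \<le> exp t\<close> at \<open>t = r / exp 1 - 1\<close>,
  multiplied by \<open>exp 1\<close>. Equality holds at \<open>r = exp 1\<close>, so
  \<open>1 / exp 1\<close> is the smallest rate that works for all \<open>r\<close>; this is the
  source of the constant in the theorem.\<close>

lemma le_exp_div_exp_1: "r \<le> exp (r / exp 1)" for r :: real
proof -
  have "r / exp 1 \<le> exp (r / exp 1 - 1)"
    using exp_ge_add_one_self[of "r / exp 1 - 1"] by simp
  then have "r / exp 1 \<le> exp (r / exp 1) / exp 1"
    by (simp only: exp_diff)
  then show ?thesis
    by (simp add: divide_le_cancel)
qed

text \<open>The exponential factor is weaker than \<open>max 1 r\<close>, but it covers both the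
  affordable and the unaffordable case, and it turns a product over agents into a sum of
  costs.\<close>

lemma utility_le_exp_cost:
  fixes p w v :: "real ^ 'm::finite"
  assumes u: "utility_function u" and "c > 0" and p: "p \<in> {0..}" and w: "w \<in> {0..}"
    and v: "v \<in> {0..}" and opt: "\<And>z. z \<in> budget_set p c \<Longrightarrow> u z \<le> u v"
  shows "u w \<le> exp ((p \<bullet> w) / c / exp 1) * u v"
proof -
  define r where "r = (p \<bullet> w) / c"
  have v_nonneg: "0 \<le> u v"
    using u v unfolding utility_function_def by auto
  have "0 \<le> p \<bullet> w"
    using p w unfolding inner_vec_def by (auto simp: less_eq_vec_def intro!: sum_nonneg)
  then have "0 \<le> r"
    using \<open>c > 0\<close> by (simp add: r_def)
  have "u w \<le> exp (r / exp 1) * u v"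
  proof (cases "r \<le> 1")
    case True
    then have "w \<in> budget_set p c"
      using w \<open>c > 0\<close> by (simp add: budget_set_def r_def)
    then have "u w \<le> 1 * u v"
      using opt by simp
    also have "\<dots> \<le> exp (r / exp 1) * u v"
      using \<open>0 \<le> r\<close> v_nonneg by (intro mult_right_mono) auto
    finally show ?thesis .
  next
    case False
    then have "r > 1" by simp
    have "p \<bullet> ((1 / r) *\<^sub>R w) = c"
      using \<open>r > 1\<close> \<open>c > 0\<close> by (auto simp: r_def)
    moreover have "(1 / r) *\<^sub>R w \<in> {0..}"
      using w \<open>r > 1\<close> by (auto simp: less_eq_vec_def)
    ultimately have "u ((1 / r) *\<^sub>R w) \<le> u v"
      by (intro opt) (auto simp: budget_set_def)
    \<comment> \<open>Concavity on the segment from \<open>0\<close> to \<open>w\<close> with weight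
      \<open>1 / r\<close>; the term at \<open>0\<close> vanishes because
      \<open>u 0 = 0\<close>.\<close>
    moreover have "(1 / r) * u w \<le> u ((1 / r) *\<^sub>R w)"
      using concave_onD[of "{0..}" u "1 / r" 0 w] u w \<open>r > 1\<close>
      by (simp add: utility_function_def)
    ultimately have "(1 / r) * u w \<le> u v"
      by linarith
    then have "u w \<le> r * u v"
      using \<open>r > 1\<close> by (simp add: field_simps)
    also have "\<dots> \<le> exp (r / exp 1) * u v"
      using le_exp_div_exp_1 v_nonneg by (rule mult_right_mono)
    finally show ?thesis .
  qed
  then show ?thesis
    by (simp add: r_def)
qed

lemma sum_inner_eq_component_sum:
  fixes p :: "real ^ 'm::finite"
  shows "(\<Sum>i\<in>A. p \<bullet> z i) = (\<Sum>j\<in>UNIV. p $ j * (\<Sum>i\<in>A. z i $ j))"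
  unfolding inner_vec_def sum_distrib_left inner_real_def by (rule sum.swap)

text \<open>Both costs are compared with the price of one unit of every good: \<open>y\<close> costs
  at most that much by feasibility, and \<open>x\<close> exactly that much by market clearing, while
  each \<open>x i\<close> stays within budget.\<close>

lemma feasible_cost_le_budget:
  assumes ce: "competitive_equilibrium A u b x p" and "feasible A y"
  shows "(\<Sum>i\<in>A. p \<bullet> y i) \<le> (\<Sum>i\<in>A. b i)"
proof -
  have p: "p $ j \<ge> 0" for j
    using ce by (simp add: competitive_equilibrium_def less_eq_vec_def)
  \<comment> \<open>A good of price zero may be left over, but then both sides are zero.\<close>
  have clear: "p $ j * (\<Sum>i\<in>A. x i $ j) = p $ j" for j
    using ce p[of j] by (cases "p $ j = 0") (auto simp: competitive_equilibrium_def)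
  have "(\<Sum>i\<in>A. p \<bullet> y i) \<le> (\<Sum>j\<in>UNIV. p $ j)"
    unfolding sum_inner_eq_component_sum
    using \<open>feasible A y\<close> p by (intro sum_mono) (auto simp: feasible_def intro!: mult_left_le)
  also have "\<dots> = (\<Sum>i\<in>A. p \<bullet> x i)"
    unfolding sum_inner_eq_component_sum clear ..
  also have "\<dots> \<le> (\<Sum>i\<in>A. b i)"
    using ce by (intro sum_mono) (auto simp: competitive_equilibrium_def budget_set_def)
  finally show ?thesis .
qed

lemma feasible_nash_welfare_le_equilibrium:
  assumes market: "fisher_market A u b" and ce: "competitive_equilibrium A u b x p"
    and y: "allocation A y" "feasible A y"
  shows "nash_welfare A u b y \<le> exp (1 / exp 1) * nash_welfare A u b x"
proof -
  define B where "B = (\<Sum>i\<in>A. b i)"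
  define P where "P = (\<Prod>i\<in>A. u i (x i) powr b i)"
  have b: "b i > 0" and u: "utility_function (u i)" and y_nonneg: "y i \<in> {0..}"
    and x_nonneg: "x i \<in> {0..}" and opt: "\<And>z. z \<in> budget_set p (b i) \<Longrightarrow> u i z \<le> u i (x i)"
    if "i \<in> A" for i
    using that market ce y
    by (auto simp: fisher_market_def competitive_equilibrium_def allocation_def)
  have p: "p \<in> {0..}"
    using ce by (simp add: competitive_equilibrium_def)
  have "B \<ge> 0"
    unfolding B_def using b by (intro sum_nonneg) (auto intro: less_imp_le)
  have "P \<ge> 0"
    unfolding P_def by (intro prod_nonneg) auto
  have u_nonneg: "0 \<le> u i z" if "i \<in> A" "z \<in> {0..}" for i z
    using u[OF that(1)] that(2) unfolding utility_function_def by auto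
  have "(\<Prod>i\<in>A. u i (y i) powr b i)
      \<le> (\<Prod>i\<in>A. exp ((p \<bullet> y i) / exp 1) * u i (x i) powr b i)"
  proof (intro prod_mono conjI)
    fix i assume i: "i \<in> A"
    have "u i (y i) powr b i \<le> (exp ((p \<bullet> y i) / b i / exp 1) * u i (x i)) powr b i"
      using utility_le_exp_cost[OF u[OF i] b[OF i] p y_nonneg[OF i] x_nonneg[OF i] opt[OF i]]
        b[OF i] u_nonneg[OF i y_nonneg[OF i]]
      by (intro powr_mono2) auto
    \<comment> \<open>The power \<open>b i\<close> cancels the division by \<open>b i\<close> in the
      exponent, leaving the plain cost of \<open>y i\<close>, which can be summed over
      agents.\<close>
    also have "\<dots> = exp ((p \<bullet> y i) / exp 1) * u i (x i) powr b i"
      using b[OF i] u_nonneg[OF i x_nonneg[OF i]] by (simp add: powr_mult exp_powr_real)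
    finally show "u i (y i) powr b i \<le> exp ((p \<bullet> y i) / exp 1) * u i (x i) powr b i" .
  qed auto
  also have "\<dots> = exp ((\<Sum>i\<in>A. p \<bullet> y i) / exp 1) * P"
    using market by (simp add: fisher_market_def P_def prod.distrib exp_sum sum_divide_distrib)
  also have "\<dots> \<le> exp (B / exp 1) * P"
    using feasible_cost_le_budget[OF ce y(2)] \<open>P \<ge> 0\<close>
    by (intro mult_right_mono) (auto simp: B_def divide_right_mono)
  finally have "nash_welfare A u b y \<le> (exp (B / exp 1) * P) powr (1 / B)"
    unfolding nash_welfare_def B_def[symmetric]
    using \<open>B \<ge> 0\<close> by (intro powr_mono2 prod_nonneg) auto
  also have "\<dots> = exp (B / exp 1 * (1 / B)) * P powr (1 / B)"
    using \<open>P \<ge> 0\<close> by (simp add: powr_mult exp_powr_real)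
  \<comment> \<open>only an inequality, since \<open>B * (1 / B) = 0\<close> for an empty market\<close>
  also have "\<dots> \<le> exp (1 / exp 1) * P powr (1 / B)"
    by (intro mult_right_mono) auto
  finally show ?thesis
    by (simp add: nash_welfare_def B_def P_def)
qed

theorem theorem1p1:
  fixes A :: "'a set"
    and u :: "'a \<Rightarrow> real ^ 'm::finite \<Rightarrow> real"
    and b :: "'a \<Rightarrow> real"
    and x y :: "'a \<Rightarrow> real ^ 'm"
    and p :: "real ^ 'm"
  assumes "fisher_market A u b"
    and "competitive_equilibrium A u b x p"
    and "nash_welfare_maximizing A u b y"
  shows "nash_welfare A u b x \<ge> (1 / exp 1) powr (1 / exp 1) * nash_welfare A u b y"
proof -
  have "nash_welfare A u b y \<le> exp (1 / exp 1) * nash_welfare A u b x"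
    using feasible_nash_welfare_le_equilibrium assms
    by (auto simp: nash_welfare_maximizing_def)
  \<comment> \<open>The constant is the reciprocal of the factor in the upper bound for
    \<open>y\<close>.\<close>
  moreover have "(1 / exp 1 :: real) powr (1 / exp 1) = 1 / exp (1 / exp 1)"
    by (simp add: powr_divide exp_powr_real)
  ultimately show ?thesis
    by (simp add: divide_le_eq mult.commute)
qed

end
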